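(* Let $G$ be a finite simple graph, let $\Gamma\subseteq\Omega(G)$ and $\emptyset\neq\Gamma'\subseteq\mathrm{MaxCritIndep}(G)$ be such that for every $A\in\Gamma'$ there exists $S\in\Gamma$ with $A\subseteq S$. If $\bigcup\Gamma'=\bigcup\Gamma$, then $G$ is a König–Egerváry graph.
   Context: For a graph $G$ and $A\subseteq V(G)$: $N(A)=\{v\in V(G): v \text{ has a neighbor in } A\}$. A set is independent if no two of its vertices are adjacent; $\mathrm{Ind}(G)$ is the family of independent sets, $\alpha(G)$ the maximum size of an independent set, and $\Omega(G)$ the family of all maximum independent sets. $\mu(G)$ is the maximum cardinality of a matching; $G$ is a König–Egerváry graph if $\alpha(G)+\mu(G)=|V(G)|$. The difference of $X\subseteq V(G)$ is $d(X)=|X|-|N(X)|$. An independent set $A$ is critical if $d(A)=\max\{d(I):I\in\mathrm{Ind}(G)\}$. A maximum critical independent set is a critical independent set of maximum cardinality among all critical independent sets; $\mathrm{MaxCritIndep}(G)$ denotes the family of all of them. *)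

theory Defs
  imports "Graph_Theory.Digraph"
begin

text \<open>
  A finite simple graph is an instance of the locale \<open>graph\<close>: a finite, loop-free, symmetric
  digraph without parallel arcs. Adjacency of \<open>u\<close> and \<open>v\<close> is \<open>u \<rightarrow>\<^bsub>G\<^esub> v\<close>.
\<close>

definition neighbors :: "('a, 'b) pre_digraph \<Rightarrow> 'a set \<Rightarrow> 'a set" where
  "neighbors G A = {v \<in> verts G. \<exists>a\<in>A. v \<rightarrow>\<^bsub>G\<^esub> a}"

definition Ind :: "('a, 'b) pre_digraph \<Rightarrow> 'a set set" where
  "Ind G = {A. A \<subseteq> verts G \<and> (\<forall>u\<in>A. \<forall>v\<in>A. \<not> u \<rightarrow>\<^bsub>G\<^esub> v)}"

definition independence_number :: "('a, 'b) pre_digraph \<Rightarrow> nat" where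
  "independence_number G = Max (card ` Ind G)"

definition max_independent_sets :: "('a, 'b) pre_digraph \<Rightarrow> 'a set set" where
  "max_independent_sets G = {S \<in> Ind G. card S = independence_number G}"

text \<open>
  An undirected edge corresponds to two antiparallel arcs, hence edges (and thus matchings)
  consist of unordered pairs of vertices rather than arcs.
\<close>

definition edges :: "('a, 'b) pre_digraph \<Rightarrow> 'a set set" where
  "edges G = {{u, v} | u v. u \<rightarrow>\<^bsub>G\<^esub> v}"

definition matchings :: "('a, 'b) pre_digraph \<Rightarrow> 'a set set set" where
  "matchings G = {M. M \<subseteq> edges G \<and> pairwise disjnt M}"

definition matching_number :: "('a, 'b) pre_digraph \<Rightarrow> nat" where
  "matching_number G = Max (card ` matchings G)"

definition Koenig_Egervary :: "('a, 'b) pre_digraph \<Rightarrow> bool" where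
  "Koenig_Egervary G \<longleftrightarrow> independence_number G + matching_number G = card (verts G)"

definition difference :: "('a, 'b) pre_digraph \<Rightarrow> 'a set \<Rightarrow> int" where
  "difference G X = int (card X) - int (card (neighbors G X))"

definition critical_independent :: "('a, 'b) pre_digraph \<Rightarrow> 'a set \<Rightarrow> bool" where
  "critical_independent G A \<longleftrightarrow>
     A \<in> Ind G \<and> difference G A = Max (difference G ` Ind G)"

definition MaxCritIndep :: "('a, 'b) pre_digraph \<Rightarrow> 'a set set" where
  "MaxCritIndep G =
     {A. critical_independent G A \<and> (\<forall>B. critical_independent G B \<longrightarrow> card B \<le> card A)}"

end

theory Submission
  imports Defs
begin

text \<open>
  Let \<open>A\<close> and \<open>B\<close> be maximum critical independent sets. The difference function is supermodular,
  so adding to \<open>A\<close> the vertices of \<open>B\<close> outside \<open>A \<union> N(A)\<close> does not decrease it; by maximality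
  there are no such vertices, i.e. \<open>B \<subseteq> A \<union> N(A)\<close>. Consequently, if \<open>A \<subseteq> S\<close> with \<open>S \<in> \<Gamma>\<close>, then
  \<open>S \<subseteq> \<Union>\<Gamma>' \<subseteq> A \<union> N(A)\<close>, and \<open>S = A\<close> because \<open>S\<close> is independent. So \<open>A\<close> is both critical and of
  maximum size. Criticality is Hall's condition for matching \<open>N(A)\<close> into \<open>A\<close>, and \<open>N(A)\<close> is the
  complement of \<open>A\<close>.
\<close>

section \<open>Hall's marriage theorem\<close>

lemma Hall:
  fixes R :: "'a \<Rightarrow> 'b set"
  assumes "finite X"
    and "\<And>x. x \<in> X \<Longrightarrow> finite (R x)"
    and "\<And>T. T \<subseteq> X \<Longrightarrow> card T \<le> card (\<Union>(R ` T))"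
  shows "\<exists>f. inj_on f X \<and> (\<forall>x\<in>X. f x \<in> R x)"
  using assms
proof (induction "card X" arbitrary: X R rule: less_induct)
  case less
  note fin = less.prems(1) and finR = less.prems(2) and hall = less.prems(3)
  show ?case
  proof (cases "X = {}")
    case True
    then show ?thesis by simp
  next
    case False
    then obtain x where x: "x \<in> X" by auto
    show ?thesis
    \<comment> \<open>Split on whether Hall's condition is tight on a proper nonempty subset
      \<open>T\<close>. If so, \<open>T\<close> and \<open>X - T\<close> are matched separately into
      disjoint ranges. If not, every such subset has a surplus, so any choice for \<open>x\<close>
      leaves a solvable problem.\<close>
    proof (cases "\<exists>T. T \<noteq> {} \<and> T \<subset> X \<and> card (\<Union>(R ` T)) \<le> card T")
      case True
      then obtain T where T: "T \<noteq> {}" "T \<subset> X" and tight: "card (\<Union>(R ` T)) \<le> card T" by blast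
      have finT: "finite T" using T fin finite_subset by blast
      let ?U = "\<Union>(R ` T)"
      have finU: "finite ?U" using finT finR T by blast
      have "\<exists>f. inj_on f T \<and> (\<forall>x\<in>T. f x \<in> R x)"
        using T fin finR hall finT by (intro less.hyps) (auto intro: psubset_card_mono)
      then obtain f where f: "inj_on f T" "\<And>x. x \<in> T \<Longrightarrow> f x \<in> R x" by blast
      have "\<exists>g. inj_on g (X - T) \<and> (\<forall>x\<in>X - T. g x \<in> R x - ?U)"
      proof (intro less.hyps)
        show "card (X - T) < card X"
          using T fin by (intro psubset_card_mono) auto
        fix W assume W: "W \<subseteq> X - T"
        have finW: "finite W" using W fin finite_subset by blast
        have finRW: "finite (\<Union>(R ` W))" using finW finR W by blast
        \<comment> \<open>Hall's condition for \<open>W \<union> T\<close> yields the one for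
          \<open>W\<close> with \<open>?U\<close> deleted: the deletion costs at most
          \<open>card ?U\<close>, which tightness bounds by \<open>card T\<close>.\<close>
        have "card W + card T = card (W \<union> T)"
          using W finW finT by (intro card_Un_disjoint[symmetric]) auto
        also have "\<dots> \<le> card (\<Union>(R ` (W \<union> T)))"
          using W T by (intro hall) auto
        also have "\<Union>(R ` (W \<union> T)) = (\<Union>x\<in>W. R x - ?U) \<union> ?U" by auto
        also have "card \<dots> \<le> card (\<Union>x\<in>W. R x - ?U) + card ?U" by (rule card_Un_le)
        finally show "card W \<le> card (\<Union>x\<in>W. R x - ?U)" using tight by linarith
      qed (use fin finR in auto)
      then obtain g where g: "inj_on g (X - T)" "\<And>x. x \<in> X - T \<Longrightarrow> g x \<in> R x - ?U" by blast
      let ?h = "\<lambda>x. if x \<in> T then f x else g x"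
      have "inj_on ?h X"
      proof (rule inj_onI)
        fix u v assume uv: "u \<in> X" "v \<in> X" "?h u = ?h v"
        have "f a \<noteq> g b" if "a \<in> T" "b \<in> X - T" for a b
          using f(2)[of a] g(2)[of b] that by force
        then show "u = v"
          using uv f(1) g(1) unfolding inj_on_def by (metis DiffI)
      qed
      moreover have "\<forall>x\<in>X. ?h x \<in> R x" using f(2) g(2) by auto
      ultimately show ?thesis by blast
    next
      case False
      have "card {x} \<le> card (\<Union>(R ` {x}))" using x by (intro hall) auto
      then obtain y where y: "y \<in> R x" by fastforce
      \<comment> \<open>Reserving \<open>y\<close> for \<open>x\<close> removes at most one
        candidate from the range of each \<open>W\<close>, which its strict surplus absorbs.\<close>
      have "\<exists>g. inj_on g (X - {x}) \<and> (\<forall>z\<in>X - {x}. g z \<in> R z - {y})"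
      proof (intro less.hyps)
        show "card (X - {x}) < card X" using fin x by (rule card_Diff1_less)
        fix W assume W: "W \<subseteq> X - {x}"
        have finW: "finite W" using W fin finite_subset by blast
        show "card W \<le> card (\<Union>z\<in>W. R z - {y})"
        proof (cases "W = {}")
          case nonempty: False
          have "W \<subset> X" using W x by auto
          then have "card W < card (\<Union>(R ` W))" using False nonempty by (meson not_le)
          moreover have "(\<Union>z\<in>W. R z - {y}) = \<Union>(R ` W) - {y}" by auto
          moreover have "card (\<Union>(R ` W)) - 1 \<le> card (\<Union>(R ` W) - {y})"
            by (simp add: card_Diff_singleton_if)
          ultimately show ?thesis by simp
        qed simp
      qed (use fin finR in auto)
      then obtain g where g: "inj_on g (X - {x})" "\<And>z. z \<in> X - {x} \<Longrightarrow> g z \<in> R z - {y}" by blast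
      have "inj_on (g(x := y)) X"
      proof (rule inj_onI)
        fix u v assume "u \<in> X" "v \<in> X" "(g(x := y)) u = (g(x := y)) v"
        then show "u = v"
          using g by (auto simp: inj_on_def split: if_splits)
      qed
      moreover have "\<forall>z\<in>X. (g(x := y)) z \<in> R z" using g(2) y by auto
      ultimately show ?thesis by blast
    qed
  qed
qed

section \<open>Neighborhoods, the difference function and critical sets\<close>

lemma neighbors_mono: "A \<subseteq> B \<Longrightarrow> neighbors G A \<subseteq> neighbors G B"
  by (auto simp: neighbors_def)

lemma neighbors_Un: "neighbors G (A \<union> B) = neighbors G A \<union> neighbors G B"
  by (auto simp: neighbors_def)

lemma Ind_neighbors_disjoint: "A \<in> Ind G \<Longrightarrow> A \<inter> neighbors G A = {}"
  by (auto simp: Ind_def neighbors_def)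

lemma Ind_subset: "A \<in> Ind G \<Longrightarrow> B \<subseteq> A \<Longrightarrow> B \<in> Ind G"
  unfolding Ind_def by blast

context graph
begin

lemma adj_sym: "u \<rightarrow>\<^bsub>G\<^esub> v \<Longrightarrow> v \<rightarrow>\<^bsub>G\<^esub> u"
  using sym_arcs by (simp add: symmetric_def sym_def)

lemma finite_neighbors: "finite (neighbors G A)"
  by (simp add: neighbors_def)

lemma finite_Ind: "finite (Ind G)"
  by (rule finite_subset[of _ "Pow (verts G)"]) (auto simp: Ind_def)

lemma finite_Ind_member: "A \<in> Ind G \<Longrightarrow> finite A"
  unfolding Ind_def using finite_subset finite_verts by blast

lemma critical_difference_ge:
  assumes "critical_independent G A" "B \<in> Ind G"
  shows "difference G B \<le> difference G A"
  using assms finite_Ind by (simp add: critical_independent_def)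

lemma critical_independentI:
  assumes "critical_independent G A" "B \<in> Ind G" "difference G A \<le> difference G B"
  shows "critical_independent G B"
  using assms critical_difference_ge[OF assms(1,2)] by (simp add: critical_independent_def)

text \<open>Cardinality is modular and neighborhoods commute with unions; for intersections only
  \<open>N(A \<inter> B) \<subseteq> N(A) \<inter> N(B)\<close> holds, hence an inequality.\<close>

lemma difference_supermodular:
  assumes "finite A" "finite B"
  shows "difference G A + difference G B \<le> difference G (A \<union> B) + difference G (A \<inter> B)"
proof -
  have "card (neighbors G (A \<inter> B)) \<le> card (neighbors G A \<inter> neighbors G B)"
    by (intro card_mono) (auto simp: neighbors_def)
  then show ?thesis
    using card_Un_Int[OF assms] card_Un_Int[OF finite_neighbors finite_neighbors, of A B]
    by (simp add: difference_def neighbors_Un)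
qed

text \<open>If \<open>T\<close> violated Hall's condition, removing its neighbors from \<open>A\<close> would increase the difference.\<close>

lemma critical_Hall_condition:
  assumes crit: "critical_independent G A" and T: "T \<subseteq> neighbors G A"
  shows "card T \<le> card (neighbors G T \<inter> A)"
proof -
  have A: "A \<in> Ind G" using crit by (simp add: critical_independent_def)
  note finA = finite_Ind_member[OF A]
  let ?B = "A - neighbors G T"
  \<comment> \<open>If a vertex of \<open>T\<close> is adjacent to some \<open>a\<close> in
    \<open>A\<close>, then \<open>a\<close> lies in \<open>N(T)\<close> and has been
    removed.\<close>
  have "T \<inter> neighbors G ?B = {}"
    using A unfolding Ind_def neighbors_def by (blast dest: adj_sym)
  then have "neighbors G ?B \<subseteq> neighbors G A - T"
    using neighbors_mono[of ?B A G] by blast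
  then have "card (neighbors G ?B) \<le> card (neighbors G A - T)"
    by (intro card_mono) (auto simp: finite_neighbors)
  also have "\<dots> = card (neighbors G A) - card T"
    using T finite_neighbors by (intro card_Diff_subset) (auto intro: finite_subset)
  finally have "card (neighbors G ?B) + card T \<le> card (neighbors G A)"
    using card_mono[OF finite_neighbors T] by linarith
  moreover have "card A = card ?B + card (neighbors G T \<inter> A)"
    using finA card_Diff_subset_Int[of A "neighbors G T"] card_mono[of A "A \<inter> neighbors G T"]
    by (simp add: Int_commute)
  moreover have "difference G ?B \<le> difference G A"
    using crit Ind_subset[OF A] by (intro critical_difference_ge) auto
  ultimately show ?thesis by (simp add: difference_def)
qed

lemma MaxCritIndep_subset_closed_neighborhood:
  assumes A: "A \<in> MaxCritIndep G" and B: "B \<in> MaxCritIndep G"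
  shows "B \<subseteq> A \<union> neighbors G A"
proof -
  have critA: "critical_independent G A" and critB: "critical_independent G B"
    using A B by (auto simp: MaxCritIndep_def)
  have IA: "A \<in> Ind G" and IB: "B \<in> Ind G"
    using critA critB by (auto simp: critical_independent_def)
  note fin = finite_Ind_member[OF IA] finite_Ind_member[OF IB]
  let ?N = "neighbors G" and ?Y = "B - (A \<union> neighbors G A)"
  have IC: "A \<union> ?Y \<in> Ind G"
    using IA IB unfolding Ind_def neighbors_def by (blast dest: adj_sym)
  \<comment> \<open>\<open>A \<union> B\<close> may fail to be independent, so criticality is
    applied to \<open>A \<inter> B\<close> instead and supermodularity transfers the bound to the
    union.\<close>
  have "difference G (A \<inter> B) \<le> difference G B"
    using critB Ind_subset[OF IA] by (intro critical_difference_ge) auto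
  then have "difference G A \<le> difference G (A \<union> B)"
    using difference_supermodular[OF fin] by linarith
  moreover have "card (A \<union> B) = card A + card (B - A)"
    using fin card_Un_disjoint[of A "B - A"] by auto
  moreover have "card (?N (A \<union> B)) = card (?N A) + card (?N B - ?N A)"
    using finite_neighbors card_Un_disjoint[of "?N A" "?N B - ?N A"] by (auto simp: neighbors_Un)
  ultimately have 1: "card (?N B - ?N A) \<le> card (B - A)"
    by (simp add: difference_def)
  have "B - A = ?Y \<union> (B \<inter> ?N A)" using Ind_neighbors_disjoint[OF IA] by auto
  then have 2: "card (B - A) = card ?Y + card (B \<inter> ?N A)"
    using fin card_Un_disjoint[of ?Y "B \<inter> ?N A"] by auto
  \<comment> \<open>Passing from \<open>A \<union> B\<close> to the independent set
    \<open>A \<union> ?Y\<close> drops \<open>B \<inter> N(A)\<close>. Hall's condition supplies at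
    least as many vertices in \<open>N(B) \<inter> A\<close>; they lie outside \<open>N(A)\<close>
    and, as shown next, outside \<open>N(?Y)\<close>, so the neighborhood shrinks by at least as
    much.\<close>
  have "card (B \<inter> ?N A) \<le> card (?N (B \<inter> ?N A) \<inter> A)"
    using critA by (intro critical_Hall_condition) auto
  also have "\<dots> \<le> card (?N B \<inter> A)"
    using fin neighbors_mono[of "B \<inter> ?N A" B] by (intro card_mono) auto
  finally have 3: "card (B \<inter> ?N A) \<le> card (?N B \<inter> A)" .
  have "?N ?Y \<inter> A = {}"
    using IB unfolding Ind_def neighbors_def by (blast dest: adj_sym)
  then have "card (?N ?Y - ?N A) + card (?N B \<inter> A) = card ((?N ?Y - ?N A) \<union> (?N B \<inter> A))"
    using finite_neighbors fin by (intro card_Un_disjoint[symmetric]) auto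
  also have "\<dots> \<le> card (?N B - ?N A)"
    using Ind_neighbors_disjoint[OF IA] neighbors_mono[of ?Y B] finite_neighbors
    by (intro card_mono) auto
  finally have 4: "card (?N ?Y - ?N A) \<le> card ?Y" using 1 2 3 by linarith
  have "card (?N (A \<union> ?Y)) = card (?N A) + card (?N ?Y - ?N A)"
    using finite_neighbors card_Un_disjoint[of "?N A" "?N ?Y - ?N A"] by (auto simp: neighbors_Un)
  moreover have cardC: "card (A \<union> ?Y) = card A + card ?Y"
    using fin by (intro card_Un_disjoint) auto
  ultimately have "critical_independent G (A \<union> ?Y)"
    using 4 by (intro critical_independentI[OF critA IC]) (simp add: difference_def)
  then have "card (A \<union> ?Y) \<le> card A" using A by (simp add: MaxCritIndep_def)
  then have "card ?Y = 0" using cardC by linarith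
  then show ?thesis using fin by simp
qed

section \<open>Matchings and their sizes\<close>

lemma finite_edges: "finite (edges G)"
  by (rule finite_subset[of _ "Pow (verts G)"]) (auto simp: edges_def adj_in_verts)

lemma finite_matchings: "finite (matchings G)"
  by (rule finite_subset[of _ "Pow (edges G)"]) (auto simp: matchings_def finite_edges)

text \<open>Each edge has an endpoint outside the independent set \<open>S\<close>, and disjoint
  edges give distinct endpoints.\<close>

lemma card_matching_le:
  assumes M: "M \<in> matchings G" and S: "S \<in> Ind G"
  shows "card M \<le> card (verts G - S)"
proof -
  have "\<exists>x. x \<in> e \<and> x \<in> verts G - S" if "e \<in> M" for e
  proof -
    from that M obtain u v where "e = {u, v}" "u \<rightarrow>\<^bsub>G\<^esub> v"
      by (auto simp: matchings_def edges_def)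
    then show ?thesis using S adj_in_verts[of u v] by (auto simp: Ind_def)
  qed
  then obtain g where g: "\<And>e. e \<in> M \<Longrightarrow> g e \<in> e" "\<And>e. e \<in> M \<Longrightarrow> g e \<in> verts G - S"
    by metis
  have "inj_on g M"
  proof (rule inj_onI)
    fix e e' assume "e \<in> M" "e' \<in> M" "g e = g e'"
    then show "e = e'"
      using g(1)[of e] g(1)[of e'] M unfolding matchings_def pairwise_def disjnt_def by auto
  qed
  then show ?thesis using g(2) by (intro card_inj_on_le) auto
qed

lemma critical_matching:
  assumes crit: "critical_independent G A"
  shows "\<exists>M \<in> matchings G. card M = card (neighbors G A)"
proof -
  have A: "A \<in> Ind G" using crit by (simp add: critical_independent_def)
  note disj = Ind_neighbors_disjoint[OF A]
  have "\<exists>f. inj_on f (neighbors G A) \<and> (\<forall>x\<in>neighbors G A. f x \<in> {a \<in> A. a \<rightarrow>\<^bsub>G\<^esub> x})"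
  proof (rule Hall)
    fix T assume T: "T \<subseteq> neighbors G A"
    have "(\<Union>x\<in>T. {a \<in> A. a \<rightarrow>\<^bsub>G\<^esub> x}) = neighbors G T \<inter> A"
      using A by (auto simp: neighbors_def Ind_def)
    then show "card T \<le> card (\<Union>x\<in>T. {a \<in> A. a \<rightarrow>\<^bsub>G\<^esub> x})"
      using critical_Hall_condition[OF crit T] by simp
  qed (use finite_neighbors finite_Ind_member[OF A] in auto)
  then obtain f where inj: "inj_on f (neighbors G A)"
    and f: "\<And>x. x \<in> neighbors G A \<Longrightarrow> f x \<in> A" "\<And>x. x \<in> neighbors G A \<Longrightarrow> f x \<rightarrow>\<^bsub>G\<^esub> x"
    by auto
  let ?e = "\<lambda>x. {f x, x}"
  \<comment> \<open>The values of \<open>f\<close> lie in \<open>A\<close>, away from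
    \<open>N(A)\<close>, so two of these edges could meet only in a common value of
    \<open>f\<close>, which injectivity excludes.\<close>
  have dis: "?e x \<inter> ?e y = {}" if "x \<in> neighbors G A" "y \<in> neighbors G A" "x \<noteq> y" for x y
    using that f(1)[of x] f(1)[of y] disj inj by (auto simp: inj_on_def)
  have "?e ` neighbors G A \<subseteq> edges G" using f(2) unfolding edges_def by blast
  moreover have "pairwise disjnt (?e ` neighbors G A)"
    unfolding pairwise_image using dis by (simp add: pairwise_def disjnt_def)
  ultimately have "?e ` neighbors G A \<in> matchings G" by (simp add: matchings_def)
  moreover have "inj_on ?e (neighbors G A)"
    using dis by (intro inj_onI) blast
  ultimately show ?thesis using card_image by blast
qed

lemma max_independent_card_ge:
  assumes "S \<in> max_independent_sets G" "I \<in> Ind G"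
  shows "card I \<le> card S"
  using assms finite_Ind by (simp add: max_independent_sets_def independence_number_def)

text \<open>A vertex outside \<open>S\<close> without neighbors in \<open>S\<close> could be added
  to \<open>S\<close>, since there are no loops.\<close>

lemma max_independent_dominating:
  assumes S: "S \<in> max_independent_sets G"
  shows "neighbors G S = verts G - S"
proof
  have IS: "S \<in> Ind G" using S by (simp add: max_independent_sets_def)
  show "neighbors G S \<subseteq> verts G - S"
    using Ind_neighbors_disjoint[OF IS] by (auto simp: neighbors_def)
  show "verts G - S \<subseteq> neighbors G S"
  proof
    fix v assume v: "v \<in> verts G - S"
    show "v \<in> neighbors G S"
    proof (rule ccontr)
      assume "v \<notin> neighbors G S"
      then have "insert v S \<in> Ind G"
        using IS v adj_not_same unfolding Ind_def neighbors_def by (blast dest: adj_sym)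
      then have "card (insert v S) \<le> card S" by (rule max_independent_card_ge[OF S])
      then show False using v finite_Ind_member[OF IS] by simp
    qed
  qed
qed

text \<open>Independence of \<open>S\<close> bounds every matching by
  \<open>card (verts G - S)\<close>; criticality provides a matching of size
  \<open>card (neighbors G S)\<close>, which is the same number because \<open>S\<close> is
  dominating.\<close>

lemma Koenig_Egervary_if_max_independent_critical:
  assumes S: "S \<in> max_independent_sets G" and crit: "critical_independent G S"
  shows "Koenig_Egervary G"
proof -
  have IS: "S \<in> Ind G" and cardS: "card S = independence_number G"
    using S by (auto simp: max_independent_sets_def)
  have "matching_number G = card (verts G - S)"
    unfolding matching_number_def
  proof (rule Max_eqI)
    show "card (verts G - S) \<in> card ` matchings G"
      using critical_matching[OF crit] unfolding max_independent_dominating[OF S] by force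
  qed (use finite_matchings card_matching_le[OF _ IS] in auto)
  moreover have "card (verts G) = card S + card (verts G - S)"
    using IS finite_Ind_member[OF IS] card_Diff_subset[of S "verts G"] card_mono[of "verts G" S]
    by (simp add: Ind_def)
  ultimately show ?thesis using cardS by (simp add: Koenig_Egervary_def)
qed

end

theorem theorem2p8:
  fixes G :: "('a, 'b) pre_digraph" and \<Gamma> \<Gamma>' :: "'a set set"
  assumes "graph G"
    and "\<Gamma> \<subseteq> max_independent_sets G"
    and "\<Gamma>' \<noteq> {}"
    and "\<Gamma>' \<subseteq> MaxCritIndep G"
    and "\<And>A. A \<in> \<Gamma>' \<Longrightarrow> \<exists>S\<in>\<Gamma>. A \<subseteq> S"
    and "\<Union>\<Gamma>' = \<Union>\<Gamma>"
  shows "Koenig_Egervary G"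
proof -
  interpret graph G by fact
  obtain A where A: "A \<in> \<Gamma>'" using assms(3) by blast
  obtain S where S: "S \<in> \<Gamma>" "A \<subseteq> S" using assms(5)[OF A] by blast
  have maxS: "S \<in> max_independent_sets G" using S assms(2) by blast
  then have "S \<inter> neighbors G S = {}"
    by (intro Ind_neighbors_disjoint) (simp add: max_independent_sets_def)
  then have "S \<inter> neighbors G A = {}" using neighbors_mono[OF S(2), of G] by blast
  \<comment> \<open>Every vertex of \<open>S\<close> lies in some member of
    \<open>\<Gamma>'\<close>, and each member is contained in the closed neighborhood of
    \<open>A\<close>.\<close>
  moreover have "S \<subseteq> A \<union> neighbors G A"
    using S(1) A assms(4,6) MaxCritIndep_subset_closed_neighborhood by blast
  ultimately have "S = A" using S(2) by blast
  then have "critical_independent G S" using A assms(4) by (auto simp: MaxCritIndep_def)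
  with maxS show ?thesis by (rule Koenig_Egervary_if_max_independent_critical)
qed

end
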